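(* Let $0<c<1$. Then $$\sup_{n\ge1}\ \sup_{p\in[0,1]}\|Q_{cn,n,p}-\mathrm{Uni}_n\|_{\mathrm{TV}}\le 1-(1-c)e^{3c/5},$$ where the outer supremum is over positive integers $n$ such that $m=cn$ is an integer (that is, the bound holds for every such $n$ and every $p\in[0,1]$). Here $Q_{m,n,p}$ is the conditional distribution of $a_m$ given $\alpha\in\mathrm{PF}_{m,n}$ under the probabilistic parking protocol with parameter $p$, and $\mathrm{Uni}_n$ is the uniform distribution on $[n]$.
   Context: $[n]=\{1,\ldots,n\}$. Probabilistic parking protocol with parameter $p\in[0,1]$: there are $m$ cars and a one-way street with $n\ge m$ spots numbered $1,\ldots,n$. Cars $1,\ldots,m$ arrive in order; car $i$ has preference $a_i\in[n]$ and first goes to spot $a_i$. If spot $a_i$ is unoccupied, the car parks there. If it is occupied, the driver tosses (once) a biased coin, independent of everything else: with probability $p$ the car moves forward and parks in the first unoccupied spot with number greater than $a_i$, if one exists; with probability $1-p$ the car moves backward and parks in the first unoccupied spot encountered (the largest unoccupied number less than $a_i$), if one exists. If there is no unoccupied spot in the chosen direction, the car fails to park. The preference list $\alpha=(a_1,\ldots,a_m)$ is chosen uniformly at random from $[n]^m$. "$\alpha\in\mathrm{PF}_{m,n}$" denotes the event that all $m$ cars with preference list $\alpha$ succeed in parking; probabilities are over both the uniform choice of $\alpha$ and the coin tosses. $Q_{m,n,p}(j)=\mathbb{P}(a_m=j\mid\alpha\in\mathrm{PF}_{m,n})$ for $j\in[n]$. The total variation distance of probability distributions $P,Q$ on $[n]$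 is $\|P-Q\|_{\mathrm{TV}}=\frac12\sum_{j=1}^n|P(j)-Q(j)|$. *)

theory Defs
  imports "HOL-Probability.Probability"
begin

definition spot_forward :: "nat \<Rightarrow> nat set \<Rightarrow> nat \<Rightarrow> nat option" where
  "spot_forward n S a =
     (if \<exists>b\<in>{1..n}. a < b \<and> b \<notin> S
      then Some (Min {b \<in> {1..n}. a < b \<and> b \<notin> S}) else None)"

definition spot_backward :: "nat \<Rightarrow> nat set \<Rightarrow> nat \<Rightarrow> nat option" where
  "spot_backward n S a =
     (if \<exists>b\<in>{1..n}. b < a \<and> b \<notin> S
      then Some (Max {b \<in> {1..n}. b < a \<and> b \<notin> S}) else None)"

(* S is the set of occupied spots and a the preference of the arriving car.
   The outcome is the spot the car takes, None meaning that it fails to park.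
   The coin shows True (move forward) with probability p. *)
definition park_car :: "real \<Rightarrow> nat \<Rightarrow> nat set \<Rightarrow> nat \<Rightarrow> nat option pmf" where
  "park_car p n S a =
     (if a \<notin> S then return_pmf (Some a)
      else map_pmf (\<lambda>forward. if forward then spot_forward n S a else spot_backward n S a)
             (bernoulli_pmf p))"

(* A car that fails to park leaves the street unchanged, and the next cars still arrive. *)
primrec park :: "real \<Rightarrow> nat \<Rightarrow> nat set \<Rightarrow> nat list \<Rightarrow> nat option list pmf" where
  "park p n S [] = return_pmf []"
| "park p n S (a # as) =
     bind_pmf (park_car p n S a) (\<lambda>s.
     bind_pmf (park p n (S \<union> set_option s) as) (\<lambda>ss. return_pmf (s # ss)))"

(* Joint law of the preference list, uniform on [n]^m, and the resulting parking outcome. *)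
definition parking_experiment ::
  "nat \<Rightarrow> nat \<Rightarrow> real \<Rightarrow> (nat list \<times> nat option list) pmf" where
  "parking_experiment m n p =
     bind_pmf (pmf_of_set {\<alpha>. length \<alpha> = m \<and> set \<alpha> \<subseteq> {1..n}}) (\<lambda>\<alpha>.
     bind_pmf (park p n {} \<alpha>) (\<lambda>ss. return_pmf (\<alpha>, ss)))"

definition all_park :: "nat list \<times> nat option list \<Rightarrow> bool" where
  "all_park \<omega> \<longleftrightarrow> None \<notin> set (snd \<omega>)"

(* Lists are indexed from 0, so the preference a_m of the last car is entry m - 1. *)
definition Q :: "nat \<Rightarrow> nat \<Rightarrow> real \<Rightarrow> nat \<Rightarrow> real" where
  "Q m n p j =
     \<P>(\<omega> in measure_pmf (parking_experiment m n p). fst \<omega> ! (m - 1) = j \<bar> all_park \<omega>)"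

definition Uni :: "nat \<Rightarrow> nat \<Rightarrow> real" where
  "Uni n = pmf (pmf_of_set {1..n})"

definition tv_dist :: "nat \<Rightarrow> (nat \<Rightarrow> real) \<Rightarrow> (nat \<Rightarrow> real) \<Rightarrow> real" where
  "tv_dist n P R = (1/2) * (\<Sum>j=1..n. \<bar>P j - R j\<bar>)"

end

theory Submission
  imports Defs "HOL-Number_Theory.Cong"
begin

text \<open>
  Write \<open>F k\<close> for the sum over all \<open>\<alpha> \<in> [n]\<^sup>k\<close> of the probability that every car with preference
  list \<open>\<alpha>\<close> parks.  If all \<open>m\<close> cars park then so do the first \<open>m - 1\<close>, so the conditional
  probability of \<open>a\<^sub>m = j\<close> is at most \<open>F (m - 1) / F m\<close>, for every \<open>j\<close>.  A distribution on \<open>[n]\<close>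
  all of whose weights are at most \<open>r / n\<close> has total variation distance at most \<open>r - 1\<close> from the
  uniform one, since this distance is the sum of the positive excesses over \<open>1 / n\<close>.

  The numbers \<open>F k\<close> do not depend on the coin, and Pollak's circle argument gives their value.
  Close the street to a circle by a further spot \<open>0\<close> that lies between \<open>n\<close> and \<open>1\<close>, and let the
  preferences range over the \<open>n + 1\<close> spots of the circle.  Now no car can fail, and a car that
  would run out of the street takes the spot \<open>0\<close> unless it is already taken.  So a list parks on
  the street iff it leaves \<open>0\<close> empty on the circle.  Every list of length \<open>k\<close> leaves exactly
  \<open>n + 1 - k\<close> spots empty, whatever the coins show, and by rotational symmetry each spot is
  empty for the same share of the lists.  Hence \<open>(n + 1) F k = (n + 1 - k) (n + 1)\<^sup>k\<close>.

  Together this bounds the distance by \<open>(m - 1) / ((n - m + 1) (n + 1))\<close>.  For \<open>m = c n\<close> this is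
  below \<open>1 - (1 - c) exp (3 c / 5)\<close>: the latter is at least \<open>(2 c / 5) / (1 - 3 c / 5)\<close> because
  \<open>exp (- x) \<ge> 1 - x\<close>, and the comparison of the two rational functions is elementary.
\<close>

section \<open>Success probabilities of preference lists\<close>

lemma measure_bind_pmf_eq_integral:
  "measure (measure_pmf (bind_pmf M N)) X = (\<integral>x. measure (measure_pmf (N x)) X \<partial>measure_pmf M)"
proof -
  have int: "integrable (measure_pmf M) (\<lambda>x. measure (measure_pmf (N x)) X)"
    by (rule measure_pmf.integrable_const_bound[where B = 1]) auto
  have "ennreal (measure (measure_pmf (bind_pmf M N)) X) =
        (\<integral>\<^sup>+x. ennreal (measure (measure_pmf (N x)) X) \<partial>measure_pmf M)"
    by (simp flip: measure_pmf.emeasure_eq_measure)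
  also have "\<dots> = ennreal (\<integral>x. measure (measure_pmf (N x)) X \<partial>measure_pmf M)"
    using int by (intro nn_integral_eq_integral) auto
  finally show ?thesis
    by (simp add: integral_nonneg_AE)
qed

definition park_prob :: "real \<Rightarrow> nat \<Rightarrow> nat set \<Rightarrow> nat list \<Rightarrow> real" where
  "park_prob p n S as = measure (measure_pmf (park p n S as)) {ss. None \<notin> set ss}"

lemma park_prob_nonneg: "0 \<le> park_prob p n S as"
  and park_prob_le_1: "park_prob p n S as \<le> 1"
  by (simp_all add: park_prob_def)

lemma park_prob_Nil: "park_prob p n S [] = 1"
  by (simp add: park_prob_def measure_return_pmf)

lemma park_prob_Cons:
  "park_prob p n S (a # as) =
     (\<integral>s. (case s of None \<Rightarrow> 0 | Some b \<Rightarrow> park_prob p n (insert b S) as) \<partial>measure_pmf (park_car p n S a))"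
proof -
  have "measure (measure_pmf (bind_pmf (park p n (S \<union> set_option s) as) (\<lambda>ss. return_pmf (s # ss))))
          {ss. None \<notin> set ss} =
        (case s of None \<Rightarrow> 0 | Some b \<Rightarrow> park_prob p n (insert b S) as)" for s
    unfolding map_pmf_def[symmetric] measure_map_pmf
    by (auto simp: park_prob_def vimage_def split: option.split)
  then show ?thesis
    unfolding park_prob_def park.simps by (subst measure_bind_pmf_eq_integral) simp
qed

lemma park_prob_snoc_le: "park_prob p n S (as @ [j]) \<le> park_prob p n S as"
proof (induction as arbitrary: S)
  case Nil
  then show ?case by (simp add: park_prob_Nil park_prob_le_1)
next
  case (Cons a as)
  have int: "integrable (measure_pmf (park_car p n S a))
      (\<lambda>s. case s of None \<Rightarrow> 0 | Some b \<Rightarrow> park_prob p n (insert b S) xs)" for xs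
    by (rule measure_pmf.integrable_const_bound[where B = 1])
       (auto simp: park_prob_nonneg park_prob_le_1 split: option.split)
  show ?case
    using Cons.IH by (auto simp: park_prob_Cons intro!: integral_mono int split: option.split)
qed

section \<open>Parking on a circle\<close>

text \<open>
  The spot found on the circle \<open>{0..n}\<close> by driving from \<open>a\<close> in steps of \<open>h\<close>.  The step \<open>1\<close> is the
  forward direction and the step \<open>n\<close>, which is \<open>-1\<close> modulo \<open>n + 1\<close>, is the backward one.
\<close>
definition probe :: "nat \<Rightarrow> nat \<Rightarrow> nat set \<Rightarrow> nat \<Rightarrow> nat" where
  "probe h n S a = (a + h * (LEAST d. (a + h * d) mod Suc n \<notin> S)) mod Suc n"

lemma probe_eqI:
  assumes "(a + h * d) mod Suc n \<notin> S" and "\<And>i. i < d \<Longrightarrow> (a + h * i) mod Suc n \<in> S"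
  shows "probe h n S a = (a + h * d) mod Suc n"
proof -
  have "(LEAST d. (a + h * d) mod Suc n \<notin> S) = d"
    using assms by (intro Least_equality) (auto simp: not_le[symmetric])
  then show ?thesis by (simp add: probe_def)
qed

lemma probe_unoccupied: "a \<le> n \<Longrightarrow> a \<notin> S \<Longrightarrow> probe h n S a = a"
  using probe_eqI[of a h 0 n S] by simp

lemma probe_le: "probe h n S a \<le> n"
  by (simp add: probe_def less_Suc_eq_le[symmetric] del: mod_Suc_le_divisor)

text \<open>A step coprime to the length of the circle visits every spot, so it finds the free one.\<close>
lemma probe_notin:
  assumes "coprime h (Suc n)" and "b \<le> n" and "b \<notin> S"
  shows "probe h n S a \<notin> S"
proof -
  obtain x where x: "[h * x = 1] (mod Suc n)"
    using cong_solve_coprime_nat[OF assms(1)] by auto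
  have "[a + h * (x * (b + n * a)) = a + (b + n * a)] (mod Suc n)"
    using cong_add[OF cong_refl[of a] cong_mult[OF x cong_refl[of "b + n * a"]]]
    by (simp add: mult.assoc)
  also have "a + (b + n * a) = b + Suc n * a" by simp
  also have "[b + Suc n * a = b] (mod Suc n)" by (simp add: cong_def del: mult_Suc)
  finally have "(a + h * (x * (b + n * a))) mod Suc n \<notin> S"
    using assms(2,3) by (simp add: cong_def)
  then show ?thesis
    unfolding probe_def by (rule LeastI)
qed

lemma backward_steps:
  assumes "d \<le> a" and "a \<le> n" shows "(a + n * d) mod Suc n = a - d"
proof -
  have "a + n * d = (a - d) + Suc n * d" using assms by simp
  then have "(a + n * d) mod Suc n = (a - d) mod Suc n" by (simp only: mod_mult_self2)
  then show ?thesis using assms by simp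
qed

lemma probe_eq_spot_forward:
  assumes "a \<in> {1..n}" and "a \<in> S" and "S \<subseteq> {1..n}"
  shows "probe 1 n S a = (case spot_forward n S a of None \<Rightarrow> 0 | Some b \<Rightarrow> b)"
proof (cases "\<exists>b\<in>{1..n}. a < b \<and> b \<notin> S")
  case True
  define B where "B = {b \<in> {1..n}. a < b \<and> b \<notin> S}"
  have fin: "finite B" and "B \<noteq> {}" using True by (auto simp: B_def)
  then have "Min B \<in> B" by (rule Min_in)
  then have b: "Min B \<le> n" "a < Min B" "Min B \<notin> S" by (auto simp: B_def)
  have "probe 1 n S a = (a + 1 * (Min B - a)) mod Suc n"
  proof (rule probe_eqI)
    fix i assume i: "i < Min B - a"
    have "a + i \<notin> B" using i Min_le[OF fin, of "a + i"] by auto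
    then show "(a + 1 * i) mod Suc n \<in> S"
      using i b assms by (cases "i = 0") (auto simp: B_def)
  qed (use b in auto)
  then show ?thesis using True b by (simp add: spot_forward_def B_def)
next
  case False
  have "probe 1 n S a = (a + 1 * (Suc n - a)) mod Suc n"
  proof (rule probe_eqI)
    fix i assume "i < Suc n - a"
    then show "(a + 1 * i) mod Suc n \<in> S"
      using False assms by (cases "i = 0") auto
  qed (use assms in auto)
  then show ?thesis using False assms by (auto simp: spot_forward_def)
qed

lemma probe_eq_spot_backward:
  assumes "a \<in> {1..n}" and "a \<in> S" and "S \<subseteq> {1..n}"
  shows "probe n n S a = (case spot_backward n S a of None \<Rightarrow> 0 | Some b \<Rightarrow> b)"
proof (cases "\<exists>b\<in>{1..n}. b < a \<and> b \<notin> S")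
  case True
  define B where "B = {b \<in> {1..n}. b < a \<and> b \<notin> S}"
  have fin: "finite B" and "B \<noteq> {}" using True by (auto simp: B_def)
  then have "Max B \<in> B" by (rule Max_in)
  then have b: "1 \<le> Max B" "Max B < a" "Max B \<notin> S" by (auto simp: B_def)
  have "probe n n S a = (a + n * (a - Max B)) mod Suc n"
  proof (rule probe_eqI)
    fix i assume i: "i < a - Max B"
    have "a - i \<notin> B" using i Max_ge[OF fin, of "a - i"] by auto
    then show "(a + n * i) mod Suc n \<in> S"
      using i b assms by (cases "i = 0") (auto simp: B_def backward_steps)
  qed (use b assms in \<open>auto simp: backward_steps\<close>)
  then show ?thesis using True b assms by (simp add: spot_backward_def B_def backward_steps)
next
  case False
  have "probe n n S a = (a + n * a) mod Suc n"
  proof (rule probe_eqI)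
    fix i assume "i < a"
    moreover from this have "a - i \<in> S" if "i \<noteq> 0"
      using that False assms(1) by (auto simp: Ball_def dest!: spec[of _ "a - i"])
    ultimately show "(a + n * i) mod Suc n \<in> S"
      using assms by (cases "i = 0") (auto simp: backward_steps)
  qed (use assms in \<open>auto simp: backward_steps\<close>)
  then show ?thesis using False assms by (auto simp: spot_backward_def backward_steps)
qed

text \<open>
  The probability that the spot \<open>v\<close> of the circle \<open>{0..n}\<close> is still empty after the cars with the
  given preferences have joined those on \<open>S\<close>.  A coin is tossed for every car; this changes
  nothing for a car that finds its preferred spot empty, as both directions lead to that spot.
\<close>
primrec empty_prob :: "real \<Rightarrow> nat \<Rightarrow> nat \<Rightarrow> nat set \<Rightarrow> nat list \<Rightarrow> real" where
  "empty_prob p n v S [] = of_bool (v \<notin> S)"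
| "empty_prob p n v S (a # as) =
     p * empty_prob p n v (insert (probe 1 n S a) S) as +
     (1 - p) * empty_prob p n v (insert (probe n n S a) S) as"

lemma empty_prob_occupied: "v \<in> S \<Longrightarrow> empty_prob p n v S as = 0"
  by (induction as arbitrary: S) auto

lemma empty_prob_preferred:
  assumes "v \<in> set as" and "v \<le> n"
  shows "empty_prob p n v S as = 0"
  using assms
proof (induction as arbitrary: S)
  case (Cons a as)
  show ?case
  proof (cases "v \<in> S \<or> v \<in> set as")
    case True
    then show ?thesis using Cons by (auto simp: empty_prob_occupied)
  next
    case False
    then have "a = v" using Cons.prems by auto
    then show ?thesis using False Cons.prems by (simp add: probe_unoccupied empty_prob_occupied)
  qed
qed simp

text \<open>
  Cars that stay off the spot \<open>0\<close> behave on the circle as on the street, and those that would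
  leave the street are the ones that take the spot \<open>0\<close>.
\<close>
lemma park_prob_eq_empty_prob:
  assumes "0 \<le> p" and "p \<le> 1" and "S \<subseteq> {1..n}" and "set as \<subseteq> {1..n}"
  shows "park_prob p n S as = empty_prob p n 0 S as"
  using assms
proof (induction as arbitrary: S)
  case Nil
  then show ?case by (auto simp: park_prob_Nil)
next
  case (Cons a as)
  let ?next = "\<lambda>s. case s of None \<Rightarrow> 0 | Some b \<Rightarrow> park_prob p n (insert b S) as"
  have a: "a \<in> {1..n}" using Cons.prems by simp
  have IH: "park_prob p n (insert b S) as = empty_prob p n 0 (insert b S) as" if "b \<in> {1..n}" for b
    using that Cons by auto
  show ?case
  proof (cases "a \<in> S")
    case False
    then show ?thesis
      using a by (simp add: park_prob_Cons park_car_def probe_unoccupied IH algebra_simps)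
  next
    case True
    have fwd: "b \<in> {1..n}" if b: "spot_forward n S a = Some b" for b
    proof -
      let ?B = "{b \<in> {1..n}. a < b \<and> b \<notin> S}"
      have "?B \<noteq> {}" "b = Min ?B" using b by (auto simp: spot_forward_def split: if_splits)
      then show ?thesis using Min_in[of ?B] by simp
    qed
    have bwd: "b \<in> {1..n}" if b: "spot_backward n S a = Some b" for b
    proof -
      let ?B = "{b \<in> {1..n}. b < a \<and> b \<notin> S}"
      have "?B \<noteq> {}" "b = Max ?B" using b by (auto simp: spot_backward_def split: if_splits)
      then show ?thesis using Max_in[of ?B] by simp
    qed
    have "park_prob p n S (a # as) =
        p * ?next (spot_forward n S a) + (1 - p) * ?next (spot_backward n S a)"
      using True Cons.prems by (simp add: park_prob_Cons park_car_def mult.commute)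
    moreover have "?next (spot_forward n S a) = empty_prob p n 0 (insert (probe 1 n S a) S) as"
      unfolding probe_eq_spot_forward[OF a True Cons.prems(3)]
      using IH[OF fwd] by (cases "spot_forward n S a") (simp_all add: empty_prob_occupied)
    moreover have "?next (spot_backward n S a) = empty_prob p n 0 (insert (probe n n S a) S) as"
      unfolding probe_eq_spot_backward[OF a True Cons.prems(3)]
      using IH[OF bwd] by (cases "spot_backward n S a") (simp_all add: empty_prob_occupied)
    ultimately show ?thesis by simp
  qed
qed

text \<open>The number of spots left empty is deterministic, as every car finds a spot on the circle.\<close>
lemma sum_empty_prob:
  assumes "S \<subseteq> {..n}" and "card S + length as \<le> Suc n"
  shows "(\<Sum>v\<le>n. empty_prob p n v S as) = real (Suc n) - real (card S + length as)"
  using assms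
proof (induction as arbitrary: S)
  case Nil
  have "(\<Sum>v\<le>n. of_bool (v \<notin> S)) = real (card ({..n} - S))"
    by (simp add: of_bool_def sum.If_cases Diff_eq Collect_neg_eq)
  also have "\<dots> = real (Suc n) - real (card S)"
    using Nil by (subst card_Diff_subset) (auto simp: finite_subset of_nat_diff)
  finally show ?case by simp
next
  case (Cons a as)
  have fin: "finite S" using Cons.prems by (auto intro: finite_subset)
  have "card S < card {..n}" using Cons.prems by simp
  then have "\<not> {..n} \<subseteq> S" using card_mono[OF fin, of "{..n}"] by auto
  then obtain b where b: "b \<le> n" "b \<notin> S" by auto
  have step: "(\<Sum>v\<le>n. empty_prob p n v (insert (probe h n S a) S) as) =
      real (Suc n) - real (card S + length (a # as))" if h: "coprime h (Suc n)" for h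
    using Cons.IH[of "insert (probe h n S a) S"] Cons.prems fin probe_notin[OF h b] probe_le by simp
  have "(\<Sum>v\<le>n. empty_prob p n v S (a # as)) =
      p * (\<Sum>v\<le>n. empty_prob p n v (insert (probe 1 n S a) S) as) +
      (1 - p) * (\<Sum>v\<le>n. empty_prob p n v (insert (probe n n S a) S) as)"
    by (simp add: sum.distrib sum_distrib_left)
  also have "\<dots> = real (Suc n) - real (card S + length (a # as))"
    by (subst (1 2) step) (simp_all add: algebra_simps)
  finally show ?case .
qed

section \<open>Rotational symmetry\<close>

definition rot :: "nat \<Rightarrow> nat \<Rightarrow> nat" where
  "rot n x = Suc x mod Suc n"

lemma inj_on_rot: "inj_on (rot n) {..n}"
  by (auto simp: inj_on_def rot_def mod_Suc split: if_splits)

lemma bij_betw_rot: "bij_betw (rot n) {..n} {..n}"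
  unfolding bij_betw_def
proof
  have "rot n ` {..n} \<subseteq> {..n}" by (auto simp: rot_def)
  then show "rot n ` {..n} = {..n}" by (intro endo_inj_surj inj_on_rot) simp
qed (rule inj_on_rot)

lemma probe_rot:
  assumes "S \<subseteq> {..n}"
  shows "probe h n (rot n ` S) (rot n a) = rot n (probe h n S a)"
proof -
  have shift: "(rot n a + h * d) mod Suc n = rot n ((a + h * d) mod Suc n)" for d
    by (simp add: rot_def mod_simps)
  have "rot n ((a + h * d) mod Suc n) \<in> rot n ` S \<longleftrightarrow> (a + h * d) mod Suc n \<in> S" for d
    using assms inj_on_image_mem_iff[OF inj_on_rot, of "(a + h * d) mod Suc n" n S] by auto
  then show ?thesis
    by (simp add: probe_def shift)
qed

lemma empty_prob_rot:
  assumes "S \<subseteq> {..n}" and "v \<le> n"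
  shows "empty_prob p n (rot n v) (rot n ` S) (map (rot n) as) = empty_prob p n v S as"
  using assms
proof (induction as arbitrary: S)
  case Nil
  then show ?case using inj_on_image_mem_iff[OF inj_on_rot, of v n S] by simp
next
  case (Cons a as)
  then show ?case
    using Cons.IH[of "insert (probe _ n S a) S"] by (simp add: probe_rot probe_le)
qed

text \<open>The preference lists of length \<open>k\<close>, on the street for \<open>A = {1..n}\<close> and on the circle for \<open>A = {..n}\<close>.\<close>
definition words :: "'a set \<Rightarrow> nat \<Rightarrow> 'a list set" where
  "words A k = {as. length as = k \<and> set as \<subseteq> A}"

lemma finite_words: "finite A \<Longrightarrow> finite (words A k)"
  using finite_lists_length_eq[of A k] by (simp add: words_def conj_commute)

lemma card_words: "finite A \<Longrightarrow> card (words A k) = card A ^ k"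
  using card_lists_length_eq[of A k] by (simp add: words_def conj_commute)

lemma bij_betw_map_words:
  assumes "bij_betw f A B" shows "bij_betw (map f) (words A k) (words B k)"
proof -
  have "bij_betw (map f) (lists A) (lists B)" using assms by (rule bij_lists)
  moreover have "map f ` words A k = words B k"
  proof
    show "map f ` words A k \<subseteq> words B k"
      using bij_betw_imp_surj_on[OF assms] by (fastforce simp: words_def)
    show "words B k \<subseteq> map f ` words A k"
    proof
      fix ys assume ys: "ys \<in> words B k"
      then have "ys \<in> map f ` lists A"
        using \<open>bij_betw (map f) (lists A) (lists B)\<close> by (auto simp: bij_betw_def words_def)
      then show "ys \<in> map f ` words A k" using ys by (auto simp: words_def)
    qed
  qed
  ultimately show ?thesis
    by (auto simp: bij_betw_def words_def intro: inj_on_subset)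
qed

lemma sum_words_Suc_snoc:
  "(\<Sum>as\<in>words A (Suc k). f as) = (\<Sum>j\<in>A. \<Sum>as\<in>words A k. f (as @ [j]))"
proof -
  have "(\<Sum>j\<in>A. \<Sum>as\<in>words A k. f (as @ [j])) = (\<Sum>(j, as)\<in>A \<times> words A k. f (as @ [j]))"
    by (rule sum.cartesian_product)
  also have "\<dots> = (\<Sum>as\<in>words A (Suc k). f as)"
  proof (rule sum.reindex_bij_witness[of _ "\<lambda>as. (last as, butlast as)" "\<lambda>(j, as). as @ [j]"])
    fix as assume "as \<in> words A (Suc k)"
    moreover obtain bs j where "as = bs @ [j]"
      using calculation by (cases as rule: rev_cases) (auto simp: words_def)
    ultimately show "(last as, butlast as) \<in> A \<times> words A k"
      and "(case (last as, butlast as) of (j, as) \<Rightarrow> as @ [j]) = as"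
      by (auto simp: words_def)
  qed (auto simp: words_def)
  finally show ?thesis ..
qed

text \<open>Rotating all preferences by one spot moves the empty spots along and permutes the lists.\<close>
lemma sum_words_empty_prob:
  assumes "v \<le> n"
  shows "(\<Sum>as\<in>words {..n} k. empty_prob p n v {} as) = (\<Sum>as\<in>words {..n} k. empty_prob p n 0 {} as)"
  using assms
proof (induction v)
  case (Suc v)
  then have "rot n v = Suc v" by (simp add: rot_def)
  then have "(\<Sum>as\<in>words {..n} k. empty_prob p n (Suc v) {} as) =
      (\<Sum>as\<in>words {..n} k. empty_prob p n (rot n v) (rot n ` {}) (map (rot n) as))"
    using sum.reindex_bij_betw[OF bij_betw_map_words[OF bij_betw_rot[of n]],
        of "empty_prob p n (Suc v) {}" k] by simp
  then show ?case using Suc empty_prob_rot[of "{}" n v] by simp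
qed simp

definition total_weight :: "real \<Rightarrow> nat \<Rightarrow> nat \<Rightarrow> real" where
  "total_weight p n k = (\<Sum>as\<in>words {1..n} k. park_prob p n {} as)"

text \<open>
  Pollak's count of parking functions.  Preference lists that contain \<open>0\<close> fill the spot \<open>0\<close>, so
  they drop out of the count of those that leave it empty.
\<close>
lemma total_weight:
  assumes "0 \<le> p" and "p \<le> 1" and "k \<le> Suc n"
  shows "real (Suc n) * total_weight p n k = (real (Suc n) - real k) * real (Suc n) ^ k"
proof -
  have "total_weight p n k = (\<Sum>as\<in>words {1..n} k. empty_prob p n 0 {} as)"
    unfolding total_weight_def using assms
    by (intro sum.cong park_prob_eq_empty_prob) (auto simp: words_def)
  also have "\<dots> = (\<Sum>as\<in>words {..n} k. empty_prob p n 0 {} as)"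
  proof (rule sum.mono_neutral_left)
    show "\<forall>as\<in>words {..n} k - words {1..n} k. empty_prob p n 0 {} as = 0"
    proof
      fix as assume as: "as \<in> words {..n} k - words {1..n} k"
      then obtain x where "x \<in> set as" "x \<notin> {1..n}" "x \<le> n"
        unfolding words_def by (auto simp: subset_iff)
      then have "0 \<in> set as" by (cases "x = 0") auto
      then show "empty_prob p n 0 {} as = 0" by (simp add: empty_prob_preferred)
    qed
  qed (auto simp: words_def finite_words[unfolded words_def])
  finally have "real (Suc n) * total_weight p n k =
      (\<Sum>v\<le>n. \<Sum>as\<in>words {..n} k. empty_prob p n 0 {} as)"
    by simp
  also have "\<dots> = (\<Sum>v\<le>n. \<Sum>as\<in>words {..n} k. empty_prob p n v {} as)"
    by (intro sum.cong refl sum_words_empty_prob[symmetric]) simp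
  also have "\<dots> = (\<Sum>as\<in>words {..n} k. \<Sum>v\<le>n. empty_prob p n v {} as)"
    by (rule sum.swap)
  also have "\<dots> = (\<Sum>as\<in>words {..n} k. real (Suc n) - real k)"
    using assms by (intro sum.cong) (auto simp: sum_empty_prob words_def)
  also have "\<dots> = (real (Suc n) - real k) * real (Suc n) ^ k"
    by (simp add: card_words)
  finally show ?thesis .
qed

section \<open>The law of the last preference\<close>

lemma prob_parking_experiment:
  assumes "n \<ge> 1"
  shows "measure (measure_pmf (parking_experiment m n p)) {\<omega>. R (fst \<omega>) \<and> all_park \<omega>} =
    (\<Sum>as\<in>words {1..n} m. of_bool (R as) * park_prob p n {} as) / real n ^ m"
proof -
  have ne: "words {1..n} m \<noteq> {}"
    using assms card_words[of "{1..n}" m] by auto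
  have "measure (measure_pmf (bind_pmf (park p n {} as) (\<lambda>ss. return_pmf (as, ss))))
      {\<omega>. R (fst \<omega>) \<and> all_park \<omega>} = of_bool (R as) * park_prob p n {} as" for as
    unfolding map_pmf_def[symmetric] measure_map_pmf
    by (auto simp: park_prob_def all_park_def vimage_def)
  then show ?thesis
    unfolding parking_experiment_def words_def[symmetric]
    using ne by (subst measure_bind_pmf_eq_integral)
      (simp add: integral_pmf_of_set finite_words card_words)
qed

lemma Q_eq:
  assumes "n \<ge> 1"
  shows "Q m n p j =
    (\<Sum>as\<in>words {1..n} m. of_bool (as ! (m - 1) = j) * park_prob p n {} as) / total_weight p n m"
proof -
  have "Q m n p j =
      measure (measure_pmf (parking_experiment m n p)) {\<omega>. fst \<omega> ! (m - 1) = j \<and> all_park \<omega>} /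
      measure (measure_pmf (parking_experiment m n p)) {\<omega>. True \<and> all_park \<omega>}"
    by (simp add: Q_def cond_prob_def)
  also have "\<dots> = (\<Sum>as\<in>words {1..n} m. of_bool (as ! (m - 1) = j) * park_prob p n {} as) / total_weight p n m"
    using prob_parking_experiment[OF assms, of m p "\<lambda>as. as ! (m - 1) = j"]
      prob_parking_experiment[OF assms, of m p "\<lambda>_. True"] assms
    by (simp add: total_weight_def)
  finally show ?thesis .
qed

lemma Q_Suc:
  assumes "n \<ge> 1" and "j \<in> {1..n}"
  shows "Q (Suc k) n p j = (\<Sum>as\<in>words {1..n} k. park_prob p n {} (as @ [j])) / total_weight p n (Suc k)"
proof -
  have "(\<Sum>as\<in>words {1..n} k. of_bool ((as @ [i]) ! k = j) * park_prob p n {} (as @ [i])) =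
      of_bool (i = j) * (\<Sum>as\<in>words {1..n} k. park_prob p n {} (as @ [i]))" for i
    unfolding sum_distrib_left by (rule sum.cong) (auto simp: words_def)
  then show ?thesis
    using assms by (simp add: Q_eq sum_words_Suc_snoc of_bool_def if_distrib[of "\<lambda>x. x * _"] cong: if_cong)
qed

lemma sum_Q_Suc:
  assumes "n \<ge> 1" and "total_weight p n (Suc k) \<noteq> 0"
  shows "(\<Sum>j=1..n. Q (Suc k) n p j) = 1"
proof -
  have "(\<Sum>j=1..n. Q (Suc k) n p j) =
      (\<Sum>j=1..n. \<Sum>as\<in>words {1..n} k. park_prob p n {} (as @ [j])) / total_weight p n (Suc k)"
    using assms by (simp add: Q_Suc sum_divide_distrib)
  also have "\<dots> = 1"
    using assms by (simp add: total_weight_def sum_words_Suc_snoc[symmetric])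
  finally show ?thesis .
qed

text \<open>The bound comes from dropping the requirement that the last car parks too.\<close>
lemma Q_Suc_le:
  assumes "n \<ge> 1" and "j \<in> {1..n}" and "total_weight p n (Suc k) \<ge> 0"
  shows "Q (Suc k) n p j \<le> total_weight p n k / total_weight p n (Suc k)"
  unfolding Q_Suc[OF assms(1,2)] total_weight_def[of p n k]
  using assms(3) by (intro divide_right_mono sum_mono park_prob_snoc_le)

section \<open>Distance from the uniform distribution\<close>

lemma tv_dist_Uni_le:
  assumes "n \<ge> 1" and "(\<Sum>j=1..n. P j) = 1" and "\<And>j. j \<in> {1..n} \<Longrightarrow> P j \<le> r / real n"
  shows "tv_dist n P (Uni n) \<le> r - 1"
proof -
  have "1 \<le> (\<Sum>j=1..n. r / real n)"
    unfolding assms(2)[symmetric] using assms(3) by (intro sum_mono)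
  then have r: "1 \<le> r" using assms(1) by simp
  have Uni: "Uni n j = 1 / real n" if "j \<in> {1..n}" for j
    using that assms(1) by (simp add: Uni_def pmf_of_set)
  \<comment> \<open>\<open>\<bar>x\<bar> = 2 max x 0 - x\<close>, and the last terms cancel as both distributions have mass \<open>1\<close>.\<close>
  have "\<bar>P j - Uni n j\<bar> \<le> 2 * ((r - 1) / real n) - (P j - 1 / real n)" if j: "j \<in> {1..n}" for j
  proof -
    have "0 \<le> (r - 1) / real n" and "P j - 1 / real n \<le> (r - 1) / real n"
      using r assms(3)[OF j] by (simp_all add: diff_divide_distrib divide_right_mono)
    then show ?thesis using Uni[OF j] by linarith
  qed
  then have "(\<Sum>j=1..n. \<bar>P j - Uni n j\<bar>) \<le> (\<Sum>j=1..n. 2 * ((r - 1) / real n) - (P j - 1 / real n))"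
    by (rule sum_mono)
  also have "\<dots> = 2 * (r - 1)"
    using assms(1,2) by (simp add: sum_subtractf)
  finally show ?thesis by (simp add: tv_dist_def)
qed

lemma tv_dist_Q_le:
  assumes "0 \<le> p" and "p \<le> 1" and "1 \<le> m" and "m \<le> n"
  shows "tv_dist n (Q m n p) (Uni n) \<le> (real m - 1) / ((real n - real m + 1) * (real n + 1))"
proof -
  obtain k where m: "m = Suc k" using assms(3) by (cases m) auto
  define N where "N = real n + 1"
  have N: "N > 0" "N - real m > 0" using assms by (auto simp: N_def)
  have w: "N * total_weight p n k = (N - real k) * N ^ k"
    "N * total_weight p n m = (N - real m) * N ^ m"
    using total_weight[of p k n] total_weight[of p m n] assms m by (simp_all add: N_def add.commute)
  have wk: "total_weight p n k = (N - real k) * N ^ k / N"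
    and wm: "total_weight p n m = (N - real m) * N ^ k"
    using w N by (simp_all add: m nonzero_eq_divide_eq mult.commute mult.left_commute)
  have pos: "total_weight p n m > 0" using N by (simp add: wm)
  define r where "r = real n * ((N - real k) / ((N - real m) * N))"
  have "total_weight p n k / total_weight p n m = r / real n"
    using N assms by (simp add: wk wm r_def field_simps)
  then have "tv_dist n (Q m n p) (Uni n) \<le> r - 1"
    using pos assms Q_Suc_le[of n _ p k] sum_Q_Suc[of n p k]
    by (intro tv_dist_Uni_le) (auto simp: m)
  also have "\<dots> = (real m - 1) / ((N - real m) * N)"
    using N by (simp add: r_def field_simps) (simp add: N_def m algebra_simps)
  finally show ?thesis by (simp add: N_def algebra_simps)
qed

lemma exp_bound:
  fixes x :: real
  assumes "0 < x" and "x < 1"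
  shows "(2 * x / 5) / (1 - 3 * x / 5) \<le> 1 - (1 - x) * exp (3 * x / 5)"
proof -
  have pos: "1 - 3 * x / 5 > 0" using assms by simp
  have "1 - 3 * x / 5 \<le> exp (- (3 * x / 5))"
    using exp_ge_add_one_self[of "- (3 * x / 5)"] by simp
  then have "exp (3 * x / 5) \<le> 1 / (1 - 3 * x / 5)"
    using pos by (simp add: exp_minus field_simps)
  then have "(1 - x) * exp (3 * x / 5) \<le> (1 - x) * (1 / (1 - 3 * x / 5))"
    using assms by (intro mult_left_mono) auto
  also have "\<dots> = 1 - (2 * x / 5) / (1 - 3 * x / 5)"
    using pos by (simp add: field_simps)
  finally show ?thesis by simp
qed

lemma rational_bound:
  fixes m n :: real
  assumes "1 \<le> m" and "m + 1 \<le> n"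
  shows "(m - 1) / ((n - m + 1) * (n + 1)) \<le> (2 * (m / n) / 5) / (1 - 3 * (m / n) / 5)"
proof -
  have "(2 * (m / n) / 5) / (1 - 3 * (m / n) / 5) = (2 * m) / (5 * n - 3 * m)"
  proof -
    have "1 - 3 * (m / n) / 5 = (5 * n - 3 * m) / (5 * n)"
      using assms by (simp add: field_simps)
    moreover have "2 * (m / n) / 5 = (2 * m) / (5 * n)" by simp
    ultimately show ?thesis
      using assms by (simp only: divide_divide_eq_left divide_divide_eq_right) simp
  qed
  moreover have "(m - 1) / ((n - m + 1) * (n + 1)) \<le> (2 * m) / (5 * n - 3 * m)"
  proof -
    have "5 * n - 3 * m \<le> 2 * ((n - m + 1) * (n + 1))"
    proof -
      have "0 \<le> (n - m - 1) * (n - 1)" using assms by simp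
      then show ?thesis using assms by (simp add: algebra_simps)
    qed
    then have "(m - 1) * (5 * n - 3 * m) \<le> m * (2 * ((n - m + 1) * (n + 1)))"
      using assms by (intro mult_mono) auto
    then show ?thesis using assms by (simp add: divide_simps mult_ac)
  qed
  ultimately show ?thesis by (simp only:)
qed

theorem proposition3p5:
  fixes c p :: real and m n :: nat
  assumes "0 < c" and "c < 1"
    and "n \<ge> 1" and "real m = c * real n"
    and "0 \<le> p" and "p \<le> 1"
  shows "tv_dist n (Q m n p) (Uni n) \<le> 1 - (1 - c) * exp (3 * c / 5)"
proof -
  have c: "c = real m / real n" using assms by simp
  have "0 < real m" and "real m < real n" using assms by simp_all
  then have mn: "1 \<le> m" "m + 1 \<le> n" by auto
  then have "1 \<le> real m" "real m + 1 \<le> real n" by auto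
  have "tv_dist n (Q m n p) (Uni n) \<le> (real m - 1) / ((real n - real m + 1) * (real n + 1))"
    using assms mn by (intro tv_dist_Q_le) auto
  also have "\<dots> \<le> (2 * c / 5) / (1 - 3 * c / 5)"
    unfolding c by (rule rational_bound) fact+
  also have "\<dots> \<le> 1 - (1 - c) * exp (3 * c / 5)"
    using assms by (intro exp_bound)
  finally show ?thesis .
qed

end
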